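(* There exists a polynomial $p\in\mathbb{R}[x]$ such that $\mathscr{W}(p)$ has nonnegative coefficients and $\mathscr{W}(p^n)$ is not real-rooted for any integer $n\ge 1$.
   Context: For a polynomial $p\in\mathbb{R}[x]$ of degree $d$, $\mathscr{W}(p)$ denotes the polynomial of degree at most $d$ defined by $\sum_{j\ge0}p(j)x^j=\mathscr{W}(p)(x)/(1-x)^{d+1}$. A polynomial is real-rooted if all its zeros are real. *)

theory Defs
  imports "HOL-Computational_Algebra.Computational_Algebra" Complex_Main
begin

definition values_fps :: "real poly \<Rightarrow> real fps" where
  "values_fps p = Abs_fps (\<lambda>j. poly p (of_nat j))"

text \<open>
  The numerator W(p) in \<open>\<Sum>\<^sub>j p(j) x^j = W(p)(x) / (1 - x)^(d + 1)\<close>, \<open>d = degree p\<close>,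
  an identity of formal power series (the denominator, a unit, is cleared).
  Existence and uniqueness are lemma \<open>W_poly_ex1\<close> below. Here \<open>degree 0 = 0\<close>, so W(0) = 0.
\<close>
definition W_poly :: "real poly \<Rightarrow> real poly" where
  "W_poly p = (THE w. degree w \<le> degree p \<and>
     values_fps p * (1 - fps_X) ^ (degree p + 1) = fps_of_poly w)"

text \<open>
  All complex zeros are real. The zero polynomial counts as real-rooted, by the usual
  convention; otherwise \<open>p = 0\<close> would be a degenerate example of a polynomial whose
  W(p^n) is never real-rooted.
\<close>
definition real_rooted :: "real poly \<Rightarrow> bool" where
  "real_rooted p \<longleftrightarrow> p = 0 \<or> (\<forall>z::complex. poly (map_poly complex_of_real p) z = 0 \<longrightarrow> z \<in> \<real>)"

lemma degree_forward_difference: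
  fixes p :: "real poly"
  assumes "degree p \<le> Suc d"
  shows "degree (pcompose p [:1, 1:] - p) \<le> d"
proof (rule degree_le, intro allI impI)
  fix i assume i: "d < i"
  have deg: "degree (pcompose p [:1, 1:]) = degree p"
    by (simp add: degree_pcompose)
  show "coeff (pcompose p [:1, 1:] - p) i = 0"
  proof (cases "i = degree p")
    case True
    have "lead_coeff (pcompose p [:1, 1:]) = lead_coeff p"
      by (subst lead_coeff_comp) auto
    then show ?thesis using True deg by simp
  next
    case False
    then have "degree p < i" using i assms by linarith
    then show ?thesis using deg by (simp add: coeff_eq_0)
  qed
qed

lemma values_fps_times_one_minus_X:
  "values_fps p * (1 - fps_X) =
     fps_const (poly p 0) + fps_X * values_fps (pcompose p [:1, 1:] - p)"
proof (rule fps_ext)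
  fix n show "fps_nth (values_fps p * (1 - fps_X)) n =
      fps_nth (fps_const (poly p 0) + fps_X * values_fps (pcompose p [:1, 1:] - p)) n"
    by (cases n) (simp_all add: values_fps_def algebra_simps poly_pcompose)
qed

lemma W_poly_exists:
  assumes "degree p \<le> d"
  shows "\<exists>w. degree w \<le> d \<and> values_fps p * (1 - fps_X) ^ (d + 1) = fps_of_poly w"
  using assms
proof (induction d arbitrary: p)
  case 0
  then obtain c where p: "p = [:c:]" by (metis degree_eq_zeroE le_zero_eq)
  have "values_fps p * (1 - fps_X) = fps_const c"
    unfolding values_fps_times_one_minus_X by (simp add: p values_fps_def fps_eq_iff)
  then show ?case by (intro exI[of _ "[:c:]"]) (simp add: fps_of_poly_const)
next
  case (Suc d)
  define q where "q = pcompose p [:1, 1:] - p"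
  have "degree q \<le> d" unfolding q_def using degree_forward_difference[OF Suc.prems] .
  from Suc.IH[OF this] obtain w where w: "degree w \<le> d"
    "values_fps q * (1 - fps_X) ^ (d + 1) = fps_of_poly w" by blast
  define v where "v = [:poly p 0:] * [:1, -1:] ^ (d + 1) + [:0, 1:] * w"
  have "degree v \<le> Suc d"
  proof -
    have "degree ([:poly p 0:] * [:1, -1:] ^ (d + 1)) \<le> Suc d"
      by (rule order.trans[OF degree_mult_le]) (simp add: degree_linear_power del: power_Suc)
    moreover have "degree ([:0, 1:] * w) \<le> Suc d"
      by (rule order.trans[OF degree_mult_le]) (use w in simp)
    ultimately show ?thesis unfolding v_def by (rule degree_add_le)
  qed
  moreover have "values_fps p * (1 - fps_X) ^ (Suc d + 1) = fps_of_poly v"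
  proof -
    have X: "fps_of_poly [:0, 1:] = (fps_X :: real fps)" "fps_of_poly [:1, -1:] = 1 - (fps_X :: real fps)"
      by (simp_all add: fps_of_poly_pCons)
    have "values_fps p * (1 - fps_X) ^ (Suc d + 1)
        = (values_fps p * (1 - fps_X)) * (1 - fps_X) ^ (d + 1)"
      by (simp add: mult.assoc)
    also have "\<dots> = fps_const (poly p 0) * (1 - fps_X) ^ (d + 1)
        + fps_X * (values_fps q * (1 - fps_X) ^ (d + 1))"
      unfolding values_fps_times_one_minus_X q_def by (simp only: distrib_right mult.assoc)
    also have "\<dots> = fps_of_poly v"
      unfolding w(2) v_def fps_of_poly_add fps_of_poly_mult fps_of_poly_power X fps_of_poly_const ..
    finally show ?thesis .
  qed
  ultimately show ?case by blast
qed

lemma W_poly_ex1: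
  "\<exists>!w. degree w \<le> degree p \<and> values_fps p * (1 - fps_X) ^ (degree p + 1) = fps_of_poly w"
  using W_poly_exists[OF order.refl, of p] by (metis fps_of_poly_eq_iff)

lemma W_poly_unique:
  assumes "degree w \<le> degree p" "values_fps p * (1 - fps_X) ^ (degree p + 1) = fps_of_poly w"
  shows "W_poly p = w"
  unfolding W_poly_def using W_poly_ex1 assms by (intro the1_equality) auto

lemma degree_W_poly_le: "degree (W_poly p) \<le> degree p"
  and values_fps_mult_eq_W_poly:
    "values_fps p * (1 - fps_X) ^ (degree p + 1) = fps_of_poly (W_poly p)"
  using theI'[OF W_poly_ex1[of p]] unfolding W_poly_def by auto

lemma values_fps_eq_W_poly:
  "values_fps p = fps_of_poly (W_poly p) / (1 - fps_X) ^ (degree p + 1)"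
proof -
  have "(1 - fps_X :: real fps) ^ (degree p + 1) \<noteq> 0"
    by (metis fps_nth_power_0 fps_sub_nth fps_one_nth fps_X_nth fps_zero_nth power_one diff_zero zero_neq_one)
  then show ?thesis
    by (metis values_fps_mult_eq_W_poly nonzero_mult_div_cancel_right)
qed

end

theory Submission
  imports Defs
begin

text \<open>
  For a real-rooted polynomial \<open>h\<^sub>0 + h\<^sub>1 x + h\<^sub>2 x\<^sup>2 + \<dots>\<close> one has
  \<open>h\<^sub>1\<^sup>2 \<ge> 2 h\<^sub>0 h\<^sub>2\<close>: if \<open>h\<^sub>0 \<noteq> 0\<close>, the difference is \<open>h\<^sub>0\<^sup>2\<close> times the sum of the squared
  reciprocals of the zeros. Written in terms of the values of a polynomial of degree \<open>d\<close>, this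
  inequality for \<open>W(p)\<close> becomes \<open>2 p(0) p(2) \<le> p(1)\<^sup>2 + (d + 1) p(0)\<^sup>2\<close>. Take
  \<open>p = 1 + 2 x\<^sup>2\<close>, for which \<open>W(p) = 1 + 3 x\<^sup>2\<close> and \<open>p(0), p(1), p(2)\<close> are \<open>1, 3, 9\<close>. For
  \<open>p^n\<close> the inequality would read \<open>2 * 9^n \<le> 9^n + 2 n + 1\<close>, which is false for \<open>n \<ge> 1\<close>.
\<close>

lemma map_poly_of_real_mult:
  "map_poly complex_of_real (p * q) = map_poly complex_of_real p * map_poly complex_of_real q"
  by (rule poly_eqI) (simp add: coeff_map_poly coeff_mult)

lemma poly_map_poly_of_real:
  "poly (map_poly complex_of_real p) (of_real x) = of_real (poly p x)"
  by (induction p) (simp_all add: map_poly_pCons)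

text \<open>Induction on the degree, splitting off one factor \<open>x - r\<close> at a time with
  \<open>r\<close> real. This avoids reciprocals of zeros, so a zero at the origin needs no separate
  case.\<close>

lemma real_rooted_imp_newton_inequality:
  assumes "real_rooted q"
  shows "2 * coeff q 0 * coeff q 2 \<le> (coeff q 1)\<^sup>2"
  using assms
proof (induction "degree q" arbitrary: q rule: less_induct)
  case less
  show ?case
  proof (cases "degree q = 0")
    case True
    then show ?thesis by (simp add: coeff_eq_0)
  next
    case False
    then have "q \<noteq> 0" by auto
    have "degree (map_poly complex_of_real q) \<noteq> 0"
      using False by (simp add: degree_map_poly)
    then have "\<not> constant (poly (map_poly complex_of_real q))"
      by (simp add: constant_degree)
    then obtain z where z: "poly (map_poly complex_of_real q) z = 0"
      using fundamental_theorem_of_algebra by blast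
    then obtain r where "z = of_real r"
      using less.prems \<open>q \<noteq> 0\<close> unfolding real_rooted_def by (auto elim: Reals_cases)
    then have "poly q r = 0" using z by (simp add: poly_map_poly_of_real)
    then obtain s where q: "q = [:- r, 1:] * s"
      unfolding poly_eq_0_iff_dvd by (rule dvdE)
    have "s \<noteq> 0" using q \<open>q \<noteq> 0\<close> by auto
    then have "degree s < degree q" unfolding q by (subst degree_mult_eq) auto
    moreover have "real_rooted s"
      using less.prems \<open>q \<noteq> 0\<close> unfolding real_rooted_def q map_poly_of_real_mult by simp
    ultimately have IH: "0 \<le> (coeff s 1)\<^sup>2 - 2 * coeff s 0 * coeff s 2"
      using less.hyps by fastforce
    have c: "coeff q 0 = - r * coeff s 0" "coeff q 1 = coeff s 0 - r * coeff s 1"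
        "coeff q 2 = coeff s 1 - r * coeff s 2"
      unfolding q by (simp_all add: coeff_pCons numeral_2_eq_2)
    \<comment> \<open>The mixed terms in \<open>r\<close> cancel, leaving a square plus a
      nonnegative multiple of the same expression for \<open>s\<close>.\<close>
    have "(coeff q 1)\<^sup>2 - 2 * coeff q 0 * coeff q 2 =
        (coeff s 0)\<^sup>2 + r\<^sup>2 * ((coeff s 1)\<^sup>2 - 2 * coeff s 0 * coeff s 2)"
      unfolding c by (simp add: power2_eq_square algebra_simps)
    moreover have "\<dots> \<ge> 0" using IH by simp
    ultimately show ?thesis by linarith
  qed
qed

lemma fps_nth_one_minus_X_power:
  fixes m :: nat
  defines "f \<equiv> (1 - fps_X :: real fps) ^ m"
  shows "fps_nth f 0 = 1" "fps_nth f 1 = - real m" "fps_nth f 2 = real m * (real m - 1) / 2"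
proof -
  have "fps_nth ((1 - fps_X :: real fps) ^ m) 0 = 1 \<and>
    fps_nth ((1 - fps_X :: real fps) ^ m) 1 = - real m \<and>
    fps_nth ((1 - fps_X :: real fps) ^ m) 2 = real m * (real m - 1) / 2"
    by (induction m) (auto simp: left_diff_distrib field_simps)
  then show "fps_nth f 0 = 1" "fps_nth f 1 = - real m" "fps_nth f 2 = real m * (real m - 1) / 2"
    unfolding f_def by auto
qed

lemma real_rooted_W_poly_values_inequality:
  assumes "real_rooted (W_poly p)"
  shows "2 * poly p 0 * poly p 2 \<le> (poly p 1)\<^sup>2 + (real (degree p) + 1) * (poly p 0)\<^sup>2"
proof -
  define m where "m = degree p + 1"
  have W: "coeff (W_poly p) i = fps_nth (values_fps p * (1 - fps_X) ^ m) i" for i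
    unfolding m_def values_fps_mult_eq_W_poly by simp
  note f = fps_nth_one_minus_X_power[of m]
  have c: "coeff (W_poly p) 0 = poly p 0"
      "coeff (W_poly p) 1 = poly p 1 - m * poly p 0"
      "coeff (W_poly p) 2 = poly p 2 - m * poly p 1 + real m * (real m - 1) / 2 * poly p 0"
    unfolding W fps_mult_nth
    using f by (simp_all add: values_fps_def numeral_2_eq_2)
  \<comment> \<open>The terms in \<open>m * poly p 0 * poly p 1\<close> and in
    \<open>m\<^sup>2\<close> cancel.\<close>
  have "(coeff (W_poly p) 1)\<^sup>2 - 2 * coeff (W_poly p) 0 * coeff (W_poly p) 2 =
      (poly p 1)\<^sup>2 + m * (poly p 0)\<^sup>2 - 2 * poly p 0 * poly p 2"
    unfolding c by (simp add: power2_eq_square field_simps)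
  then show ?thesis
    using real_rooted_imp_newton_inequality[OF assms] unfolding m_def by (simp add: add.commute)
qed

text \<open>Each factor \<open>1 - fps_X\<close> passes to the forward difference:
  \<open>1 + 2 x\<^sup>2\<close> gives \<open>2 + 4 x\<close>, which gives the constant
  \<open>4\<close>.\<close>

lemma W_poly_one_plus_two_square: "W_poly [:1, 0, 2:] = [:1, 0, 3:]"
proof (rule W_poly_unique)
  let ?Y = "1 - fps_X :: real fps"
  have d0: "values_fps [:1, 0, 2:] * ?Y = 1 + fps_X * values_fps [:2, 4:]"
    unfolding values_fps_times_one_minus_X by (simp add: pcompose_pCons)
  have d1: "values_fps [:2, 4:] * ?Y = 2 + fps_X * values_fps [:4:]"
    unfolding values_fps_times_one_minus_X by (simp add: pcompose_pCons numeral_fps_const)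
  have d2: "values_fps [:4:] * ?Y = 4"
    unfolding values_fps_times_one_minus_X
    by (simp add: values_fps_def numeral_fps_const fps_zero_def[symmetric])
  have "values_fps [:1, 0, 2:] * ?Y ^ 3 =
      ?Y ^ 2 + fps_X * (2 * ?Y + fps_X * (values_fps [:4:] * ?Y))"
  proof -
    have "values_fps [:1, 0, 2:] * ?Y ^ 3 = (values_fps [:1, 0, 2:] * ?Y) * ?Y ^ 2"
      by (simp add: power3_eq_cube power2_eq_square)
    also have "\<dots> = ?Y ^ 2 + fps_X * ((values_fps [:2, 4:] * ?Y) * ?Y)"
      unfolding d0 by (simp only: distrib_right mult_1_left power2_eq_square mult.assoc)
    also have "\<dots> = ?Y ^ 2 + fps_X * (2 * ?Y + fps_X * (values_fps [:4:] * ?Y))"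
      unfolding d1 by (simp only: distrib_right mult.assoc)
    finally show ?thesis .
  qed
  also have "\<dots> = 1 + 3 * fps_X ^ 2"
    unfolding d2 by (simp add: power2_eq_square algebra_simps)
  also have "\<dots> = fps_of_poly [:1, 0, 3:]"
    by (simp add: fps_of_poly_pCons power2_eq_square numeral_fps_const mult_ac)
  finally have "values_fps [:1, 0, 2:] * ?Y ^ 3 = fps_of_poly [:1, 0, 3:]" .
  then show "values_fps [:1, 0, 2:] * (1 - fps_X) ^ (degree [:1, 0, 2 :: real:] + 1) =
      fps_of_poly [:1, 0, 3:]"
    by (simp add: numeral_3_eq_3)
qed simp

theorem theorem1p7:
  "\<exists>p :: real poly. (\<forall>i. coeff (W_poly p) i \<ge> 0) \<and>
     (\<forall>n::nat. n \<ge> 1 \<longrightarrow> \<not> real_rooted (W_poly (p ^ n)))"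
proof (intro exI[of _ "[:1, 0, 2:]"] conjI allI impI notI)
  fix i show "coeff (W_poly [:1, 0, 2:]) i \<ge> 0"
    by (simp add: W_poly_one_plus_two_square coeff_pCons split: nat.split)
next
  fix n :: nat
  assume n: "n \<ge> 1" and rr: "real_rooted (W_poly ([:1, 0, 2:] ^ n))"
  have "degree ([:1, 0, 2 :: real:] ^ n) = 2 * n"
    by (simp add: degree_power_eq)
  then have "2 * 9 ^ n \<le> (3 ^ n)\<^sup>2 + (2 * real n + 1)"
    using real_rooted_W_poly_values_inequality[OF rr] by (simp add: poly_power)
  moreover have "((3::real) ^ n)\<^sup>2 = 9 ^ n"
    by (simp add: power2_eq_square flip: power_mult_distrib)
  \<comment> \<open>The two facts above leave \<open>9 ^ n \<le> 2 n + 1\<close>, whereas Bernoulli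
    gives \<open>9 ^ n \<ge> 8 n + 1\<close>, which is larger for \<open>n \<ge> 1\<close>.\<close>
  moreover have "1 + real n * 8 \<le> (1 + 8) ^ n"
    by (rule Bernoulli_inequality) simp
  ultimately show False using n by simp
qed

end
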